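(* Let $n>1$ be an integer. The quadratic unitary Cayley graph $G_n$ is periodic if and only if $n\in\{2,4,p^s,2p^s\}$ for some prime $p$ with $p\equiv 3 \pmod 4$ and some positive integer $s$.
   Context: The quadratic unitary Cayley graph $G_n$ is the simple undirected graph with vertex set $\mathbb{Z}_n$ in which two distinct vertices $a,b$ are adjacent if and only if $a-b\equiv u^2$ or $a-b\equiv -u^2 \pmod n$ for some integer $u$ with $1\le u\le n-1$ and $\gcd(u,n)=1$. For a finite simple undirected graph $\Gamma$ with adjacency matrix $A$, the transition matrix is $H(t)=\exp(-\mathbf{i}tA)$, $t\in\mathbb{R}$, where $\mathbf{i}=\sqrt{-1}$. $\Gamma$ is periodic (admits periodicity) if there are a real number $t>0$ and a complex number $\gamma$ of unit modulus such that $H(t)=\gamma I$, where $I$ is the identity matrix. *)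

theory Defs
  imports
    "HOL-Number_Theory.Cong"
    "HOL-Analysis.Analysis"
    "Graph_Theory.Pair_Digraph"
    "Jordan_Normal_Form.Matrix"
begin

text \<open>
  Undirected graphs are digraphs with a symmetric arc relation; the simple finite ones are
  those satisfying the locale \<^locale>\<open>pair_graph\<close>. The residues modulo \<open>n\<close> are represented
  by \<open>0, \<dots>, n - 1\<close>.
\<close>

definition quadratic_unitary_Cayley_graph :: "nat \<Rightarrow> nat pair_pre_digraph" where
  "quadratic_unitary_Cayley_graph n =
     \<lparr>pverts = {0..<n},
      parcs = {(a, b). a \<in> {0..<n} \<and> b \<in> {0..<n} \<and> a \<noteq> b \<and>
        (\<exists>u::int. 1 \<le> u \<and> u \<le> int n - 1 \<and> gcd u (int n) = 1 \<and>
           ([int a - int b = u\<^sup>2] (mod int n) \<or> [int a - int b = - (u\<^sup>2)] (mod int n)))}\<rparr>"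

lemma pair_graph_quadratic_unitary_Cayley_graph:
  "pair_graph (quadratic_unitary_Cayley_graph n)"
proof -
  let ?P = "parcs (quadratic_unitary_Cayley_graph n)"
  have "?P \<subseteq> {0..<n} \<times> {0..<n}"
    by (auto simp: quadratic_unitary_Cayley_graph_def)
  then have fin: "finite ?P"
    by (rule finite_subset) simp
  have swap: "[y - x = c] (mod m)" if "[x - y = - c] (mod m)" for x y c m :: int
    using that cong_minus_minus_iff[of "x - y" "- c" m] by simp
  have "sym ?P"
  proof (rule symI)
    fix a b assume "(a, b) \<in> ?P"
    then obtain u :: int where ab: "a \<in> {0..<n}" "b \<in> {0..<n}" "a \<noteq> b"
      and u: "1 \<le> u" "u \<le> int n - 1" "gcd u (int n) = 1"
      and c: "[int a - int b = u\<^sup>2] (mod int n) \<or> [int a - int b = - (u\<^sup>2)] (mod int n)"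
      by (auto simp: quadratic_unitary_Cayley_graph_def)
    have "[int b - int a = u\<^sup>2] (mod int n) \<or> [int b - int a = - (u\<^sup>2)] (mod int n)"
      using c swap[of "int a" "int b" "u\<^sup>2" "int n"] swap[of "int a" "int b" "- (u\<^sup>2)" "int n"]
      by auto
    with ab u show "(b, a) \<in> ?P"
      by (auto simp: quadratic_unitary_Cayley_graph_def)
  qed
  with fin show ?thesis
    by unfold_locales (auto simp: symmetric_def quadratic_unitary_Cayley_graph_def)
qed

text \<open>Rows and columns of the adjacency matrix follow the increasing order of the vertices.\<close>

definition adjacency_matrix :: "'a::linorder pair_pre_digraph \<Rightarrow> complex mat" where
  "adjacency_matrix G =
     (let vs = sorted_list_of_set (pverts G)
      in mat (length vs) (length vs) (\<lambda>(i, j). if (vs ! i, vs ! j) \<in> parcs G then 1 else 0))"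

lemma adjacency_matrix_quadratic_unitary_Cayley_graph:
  "adjacency_matrix (quadratic_unitary_Cayley_graph n) =
     mat n n (\<lambda>(i, j). if (i, j) \<in> parcs (quadratic_unitary_Cayley_graph n) then 1 else 0)"
proof -
  have "pverts (quadratic_unitary_Cayley_graph n) = {0..<n}"
    by (simp add: quadratic_unitary_Cayley_graph_def)
  then show ?thesis
    by (auto simp: adjacency_matrix_def Let_def intro!: eq_matI)
qed

text \<open>
  The exponential power series, summed entry by entry; each of these series converges
  by \<open>summable_mat_exp\<close> below.
\<close>

definition mat_exp :: "complex mat \<Rightarrow> complex mat" where
  "mat_exp A = mat (dim_row A) (dim_row A) (\<lambda>(i, j). \<Sum>k. (A ^\<^sub>m k) $$ (i, j) / fact k)"

lemma summable_mat_exp: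
  fixes A :: "complex mat"
  assumes A: "A \<in> carrier_mat n n" and ij: "i < n" "j < n"
  shows "summable (\<lambda>k. (A ^\<^sub>m k) $$ (i, j) / fact k)"
proof -
  define M where "M = (\<Sum>i<n. \<Sum>j<n. norm (A $$ (i, j)))"
  have M0: "M \<ge> 0"
    unfolding M_def by (intro sum_nonneg) auto
  have M: "norm (A $$ (p, q)) \<le> M" if "p < n" "q < n" for p q
  proof -
    have "norm (A $$ (p, q)) \<le> (\<Sum>j<n. norm (A $$ (p, j)))"
      using that by (intro member_le_sum) auto
    also have "\<dots> \<le> M"
      unfolding M_def using that
      by (intro member_le_sum[of p _ "\<lambda>i. \<Sum>j<n. norm (A $$ (i, j))"]) (auto intro: sum_nonneg)
    finally show ?thesis .
  qed
  have bound: "norm ((A ^\<^sub>m k) $$ (p, q)) \<le> (real n * M) ^ k" if "p < n" "q < n" for k p q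
    using that
  proof (induction k arbitrary: p q)
    case 0
    then show ?case using A by auto
  next
    case (Suc k)
    have "(A ^\<^sub>m Suc k) $$ (p, q) = (\<Sum>l<n. (A ^\<^sub>m k) $$ (p, l) * A $$ (l, q))"
      using A Suc.prems pow_carrier_mat[OF A, of k]
      by (simp add: scalar_prod_def atLeast0LessThan)
    also have "norm \<dots> \<le> (\<Sum>l<n. norm ((A ^\<^sub>m k) $$ (p, l)) * norm (A $$ (l, q)))"
      by (rule order_trans[OF norm_sum]) (simp add: norm_mult)
    also have "\<dots> \<le> (\<Sum>l<n. (real n * M) ^ k * M)"
      using Suc M M0 by (intro sum_mono mult_mono) auto
    also have "\<dots> = (real n * M) ^ Suc k"
      by simp
    finally show ?case .
  qed
  show ?thesis
  proof (rule summable_comparison_test)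
    show "\<exists>N. \<forall>k\<ge>N. norm ((A ^\<^sub>m k) $$ (i, j) / fact k) \<le> inverse (fact k) * (real n * M) ^ k"
      using bound[OF ij] by (auto simp: norm_divide divide_simps)
    show "summable (\<lambda>k. inverse (fact k) * (real n * M) ^ k)"
      by (rule summable_exp)
  qed
qed

definition transition_matrix :: "'a::linorder pair_pre_digraph \<Rightarrow> real \<Rightarrow> complex mat" where
  "transition_matrix G t = mat_exp ((- \<i> * complex_of_real t) \<cdot>\<^sub>m adjacency_matrix G)"

definition periodic_graph :: "'a::linorder pair_pre_digraph \<Rightarrow> bool" where
  "periodic_graph G \<longleftrightarrow>
     (\<exists>t::real. \<exists>\<gamma>::complex. t > 0 \<and> norm \<gamma> = 1 \<and>
        transition_matrix G t = \<gamma> \<cdot>\<^sub>m 1\<^sub>m (card (pverts G)))"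

end

theory Submission
  imports Defs
    "HOL-Number_Theory.Euler_Criterion"
    "Jordan_Normal_Form.Char_Poly"
begin

text \<open>
  Write \<open>S\<close> for the set of squares of units up to sign. The graph is a circulant, with eigenvalues
  \<open>\<theta>\<^sub>m = \<Sum>\<^bsub>d\<in>S\<^esub> \<zeta>\<^bsup>md\<^esup>\<close>, and \<open>H(t) = \<gamma>I\<close> says that \<open>exp(-it\<theta>\<^sub>m) = \<gamma>\<close> for all \<open>m\<close>. As the \<open>\<theta>\<^sub>m\<close> sum to
  \<open>0\<close> and \<open>\<theta>\<^sub>0 = |S|\<close>, periodicity forces all of them to be rational, hence integers. Then
  \<open>\<theta>\<^bsub>ma\<^esub> = \<theta>\<^sub>m\<close> for every unit \<open>a\<close>, and by Fourier inversion the group \<open>S\<close> contains all units.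
  Conversely, if \<open>S\<close> consists of all units, the eigenvalues are Ramanujan sums, which are integers,
  and \<open>H(2\<pi>) = I\<close>. All units are squares up to sign exactly for the listed \<open>n\<close>: otherwise \<open>n\<close> is
  divisible by \<open>8\<close>, by a prime \<open>p \<equiv> 1 (mod 4)\<close>, or by a product of two coprime numbers each of
  which is \<open>4\<close> or an odd prime.
\<close>

section \<open>Roots of unity\<close>

definition zeta :: "nat \<Rightarrow> int \<Rightarrow> complex" where
  "zeta n k = cis (2 * pi * of_int k / of_nat n)"

lemma zeta_0 [simp]: "zeta n 0 = 1"
  by (simp add: zeta_def)

lemma zeta_add: "zeta n (a + b) = zeta n a * zeta n b"
  by (simp add: zeta_def cis_mult add_divide_distrib distrib_left)

lemma zeta_diff: "zeta n (a - b) = zeta n a * zeta n (- b)"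
  using zeta_add[of n a "- b"] by simp

lemma zeta_power: "zeta n k ^ j = zeta n (k * int j)"
  by (simp add: zeta_def Complex.DeMoivre mult_ac)

lemma zeta_eq_1_iff:
  assumes "n > 0"
  shows "zeta n k = 1 \<longleftrightarrow> int n dvd k"
proof
  assume "zeta n k = 1"
  then have "cos (2 * pi * of_int k / of_nat n) = 1"
    by (simp add: zeta_def complex_eq_iff)
  then obtain j :: int where "2 * pi * of_int k / of_nat n = of_int j * 2 * pi"
    using cos_one_2pi_int by blast
  then have "real_of_int k = of_int (j * int n)"
    using assms by (simp add: field_simps)
  then show "int n dvd k"
    by (simp only: of_int_eq_iff) simp
next
  assume "int n dvd k"
  then obtain j where "k = int n * j" ..
  then show "zeta n k = 1"
    using assms cis_multiple_2pi[of "of_int j"] by (simp add: zeta_def field_simps)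
qed

lemma zeta_cong:
  assumes "n > 0" "[a = b] (mod int n)"
  shows "zeta n a = zeta n b"
proof -
  have "zeta n (a - b) = 1"
    using assms by (simp add: zeta_eq_1_iff cong_iff_dvd_diff)
  then show ?thesis
    using zeta_add[of n "a - b" b] by simp
qed

text \<open>Orthogonality of characters: off the multiples of \<open>n\<close> this is a geometric
  series whose ratio is an \<open>n\<close>-th root of unity other than 1.\<close>

lemma sum_zeta:
  assumes "n > 0"
  shows "(\<Sum>d\<in>{0..<int n}. zeta n (k * d)) = (if int n dvd k then of_nat n else 0)"
proof (cases "int n dvd k")
  case True
  then have "zeta n (k * d) = 1" for d
    using assms by (simp add: zeta_eq_1_iff)
  then show ?thesis
    using True by simp
next
  case False
  have "(\<Sum>d\<in>{0..<int n}. zeta n (k * d)) = (\<Sum>j<n. zeta n k ^ j)"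
    by (rule sum.reindex_bij_witness[of _ int nat]) (auto simp: zeta_power)
  also have "\<dots> = 0"
  proof -
    have "zeta n k \<noteq> 1" "zeta n k ^ n = 1"
      using False assms by (simp_all add: zeta_eq_1_iff zeta_power)
    then show ?thesis
      by (simp add: geometric_sum)
  qed
  finally show ?thesis
    using False by simp
qed

lemma sum_periodic_shift:
  fixes f :: "int \<Rightarrow> 'a::comm_monoid_add"
  assumes "n > 0" and per: "\<And>a b. [a = b] (mod n) \<Longrightarrow> f a = f b"
  shows "(\<Sum>d\<in>{0..<n}. f (d + c)) = (\<Sum>d\<in>{0..<n}. f d)"
proof (rule sum.reindex_bij_witness[of _ "\<lambda>d. (d - c) mod n" "\<lambda>d. (d + c) mod n"])
  show "f ((d + c) mod n) = f (d + c)" for d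
    by (rule per) simp
qed (use assms in \<open>auto simp: mod_simps\<close>)

section \<open>The ring generated by a root of unity\<close>

text \<open>The ring \<int>[w]. Given by polynomials, it inherits closure under ring operations from
  homomorphisms, and its elements come with coefficients for an integer matrix.\<close>

definition int_span :: "complex \<Rightarrow> complex set" where
  "int_span w = range (\<lambda>p. poly (of_int_poly p) w)"

lemma int_span_of_int [simp]: "of_int k \<in> int_span w"
proof -
  have "of_int k = poly (of_int_poly [:k:]) w"
    by (simp add: Polynomial.map_poly_pCons)
  then show ?thesis
    unfolding int_span_def by blast
qed

lemma int_span_of_nat [simp]: "of_nat k \<in> int_span w"
  using int_span_of_int[of "int k" w] by simp

lemma int_span_power [simp]: "w ^ k \<in> int_span w"
proof -
  have "w ^ k = poly (of_int_poly (Polynomial.monom 1 k)) w"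
    by (simp add: map_poly_monom poly_monom)
  then show ?thesis
    unfolding int_span_def by blast
qed

lemma int_span_add: "x \<in> int_span w \<Longrightarrow> y \<in> int_span w \<Longrightarrow> x + y \<in> int_span w"
  unfolding int_span_def by (auto simp flip: poly_add of_int_poly_hom.hom_add)

lemma int_span_mult: "x \<in> int_span w \<Longrightarrow> y \<in> int_span w \<Longrightarrow> x * y \<in> int_span w"
  unfolding int_span_def by (auto simp flip: poly_mult of_int_poly_hom.hom_mult)

lemma int_span_pow: "x \<in> int_span w \<Longrightarrow> x ^ k \<in> int_span w"
  by (induction k) (use int_span_of_nat[of 1 w] in \<open>auto intro: int_span_mult\<close>)

lemma int_span_sum: "(\<And>i. i \<in> I \<Longrightarrow> f i \<in> int_span w) \<Longrightarrow> sum f I \<in> int_span w"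
  by (induction I rule: infinite_finite_induct)
     (use int_span_of_nat[of 0 w] in \<open>auto intro: int_span_add\<close>)

text \<open>The characteristic polynomial of an integer matrix is monic with integer
  coefficients.\<close>

lemma eigenvalue_int_mat_algebraic_int:
  fixes M :: "int mat" and x :: complex
  assumes M: "M \<in> carrier_mat n n" and ev: "eigenvalue (map_mat of_int M) x"
  shows "algebraic_int x"
proof -
  have "poly (char_poly (map_mat of_int M)) x = 0"
    using ev M by (subst (asm) eigenvalue_root_char_poly) auto
  then have "poly (of_int_poly (char_poly M)) x = 0"
    by (simp only: of_int_hom.char_poly_hom[OF M])
  moreover have "lead_coeff (char_poly M) = 1"
    using degree_monic_char_poly[OF M] by simp
  ultimately show ?thesis
    by (auto simp: algebraic_int_altdef_ipoly)
qed

text \<open>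
  Multiplication by an element of \<open>\<int>[w]\<close> acts on the powers \<open>1, w, \<dots>, w\<^bsup>n-1\<^esup>\<close> by an integer matrix.
\<close>

lemma int_span_algebraic_int:
  assumes "n > 0" "w ^ n = 1" "x \<in> int_span w"
  shows "algebraic_int x"
proof -
  obtain p where p: "x = poly (of_int_poly p) w"
    using assms(3) by (auto simp: int_span_def)
  \<comment> \<open>Row \<open>i\<close> expands \<open>x * w ^ i\<close> in powers of
    \<open>w\<close>, with the exponents \<open>i + k\<close> reduced modulo \<open>n\<close> by
    \<open>w ^ n = 1\<close>.\<close>
  define M :: "int mat" where
    "M = mat n n (\<lambda>(i, j). \<Sum>k | k \<le> degree p \<and> (i + k) mod n = j. Polynomial.coeff p k)"
  have M: "M \<in> carrier_mat n n"
    by (simp add: M_def)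
  define v where "v = vec n (\<lambda>j. w ^ j)"
  have wmod: "w ^ (k mod n) = w ^ k" for k
  proof -
    have "w ^ k = w ^ (k mod n + n * (k div n))"
      by simp
    also have "\<dots> = w ^ (k mod n)"
      by (simp only: power_add power_mult assms(2)) simp
    finally show ?thesis ..
  qed
  have row: "(\<Sum>j<n. of_int (M $$ (i, j)) * w ^ j) = x * w ^ i" if "i < n" for i
  proof -
    have "(\<Sum>j<n. of_int (M $$ (i, j)) * w ^ j)
        = (\<Sum>j<n. \<Sum>k | k \<in> {..degree p} \<and> (i + k) mod n = j. of_int (Polynomial.coeff p k) * w ^ (i + k))"
      using that by (intro sum.cong) (auto simp: M_def sum_distrib_right wmod intro!: sum.cong)
    also have "\<dots> = (\<Sum>k\<in>{..degree p}. of_int (Polynomial.coeff p k) * w ^ (i + k))"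
      using assms(1) by (intro sum.group) auto
    also have "\<dots> = x * w ^ i"
      by (simp add: p poly_altdef sum_distrib_left power_add mult_ac)
    finally show ?thesis .
  qed
  have "map_mat of_int M *\<^sub>v v = x \<cdot>\<^sub>v v"
    by (rule eq_vecI) (use M row in \<open>auto simp: v_def scalar_prod_def atLeast0LessThan\<close>)
  moreover have "v \<noteq> 0\<^sub>v n"
  proof
    assume "v = 0\<^sub>v n"
    then have "v $ 0 = 0\<^sub>v n $ 0"
      by simp
    then show False
      using assms(1) by (simp add: v_def)
  qed
  moreover have "v \<in> carrier_vec n"
    by (simp add: v_def)
  ultimately have "eigenvalue (map_mat of_int M) x"
    using M unfolding eigenvalue_def eigenvector_def by auto
  then show ?thesis
    by (rule eigenvalue_int_mat_algebraic_int[OF M])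
qed

text \<open>Frobenius modulo \<open>p\<close>: the inner binomial coefficients are divisible by
  \<open>p\<close>, and the quotient stays in \<int>[w].\<close>

lemma int_span_add_power_prime:
  assumes "prime p" "x \<in> int_span w" "y \<in> int_span w"
  shows "\<exists>r\<in>int_span w. (x + y) ^ p = x ^ p + y ^ p + of_nat p * r"
proof -
  let ?f = "\<lambda>k. of_nat ((p choose k) div p) * x ^ k * y ^ (p - k)"
  have p: "p > 1"
    using assms(1) prime_gt_1_nat by blast
  have "(x + y) ^ p = (\<Sum>k\<le>p. of_nat (p choose k) * x ^ k * y ^ (p - k))"
    by (rule binomial_ring)
  also have "{..p} = insert 0 (insert p {0<..<p})"
    using p by auto
  also have "(\<Sum>k\<in>\<dots>. of_nat (p choose k) * x ^ k * y ^ (p - k))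
      = x ^ p + y ^ p + (\<Sum>k\<in>{0<..<p}. of_nat (p choose k) * x ^ k * y ^ (p - k))"
    using p by simp
  also have "(\<Sum>k\<in>{0<..<p}. of_nat (p choose k) * x ^ k * y ^ (p - k)) = of_nat p * (\<Sum>k\<in>{0<..<p}. ?f k)"
  proof -
    have "of_nat (p choose k) = (of_nat p * of_nat ((p choose k) div p) :: complex)"
      if "k \<in> {0<..<p}" for k
      using that assms(1) dvd_choose_prime[of k p] by (simp flip: of_nat_mult)
    then show ?thesis
      by (auto simp: sum_distrib_left mult_ac intro!: sum.cong)
  qed
  finally have "(x + y) ^ p = x ^ p + y ^ p + of_nat p * (\<Sum>k\<in>{0<..<p}. ?f k)" .
  then show ?thesis
    using assms by (intro bexI[of _ "sum ?f {0<..<p}"]) (auto intro!: int_span_sum int_span_mult int_span_pow)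
qed

lemma int_span_sum_power_prime:
  assumes "prime p" "finite I" "\<And>i. i \<in> I \<Longrightarrow> f i \<in> int_span w"
  shows "\<exists>r\<in>int_span w. (\<Sum>i\<in>I. f i) ^ p = (\<Sum>i\<in>I. f i ^ p) + of_nat p * r"
  using assms(2,3)
proof (induction I rule: finite_induct)
  case empty
  have "p > 0"
    using assms(1) prime_gt_0_nat by blast
  then show ?case
    using int_span_of_nat[of 0 w] by (intro bexI[of _ 0]) auto
next
  case (insert i I)
  obtain r where r: "r \<in> int_span w" "(\<Sum>i\<in>I. f i) ^ p = (\<Sum>i\<in>I. f i ^ p) + of_nat p * r"
    using insert by auto
  obtain s where s: "s \<in> int_span w"
      "(f i + (\<Sum>i\<in>I. f i)) ^ p = f i ^ p + (\<Sum>i\<in>I. f i) ^ p + of_nat p * s"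
    using int_span_add_power_prime[OF assms(1), of "f i" w "\<Sum>i\<in>I. f i"] insert.prems
    by (auto intro: int_span_sum)
  show ?case
    by (rule bexI[of _ "r + s"]) (use insert r s in \<open>auto simp: algebra_simps intro: int_span_add\<close>)
qed

section \<open>Spectrum of the graph\<close>

text \<open>The Fourier transform of the indicator of \<open>S\<close>; for a group of units, a
  Gauss period. As a predicate on all integers, \<open>S\<close> can be evaluated at shifted
  arguments without reduction.\<close>

definition gauss_period :: "nat \<Rightarrow> (int \<Rightarrow> bool) \<Rightarrow> int \<Rightarrow> complex" where
  "gauss_period n S m = (\<Sum>d | d \<in> {0..<int n} \<and> S d. zeta n (m * d))"

text \<open>The connection set of the graph. Here \<open>u\<close> is any integer;
  \<open>adjacent_iff\<close> brings it into the range used by the graph.\<close>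

definition signed_unit_square :: "nat \<Rightarrow> int \<Rightarrow> bool" where
  "signed_unit_square n d \<longleftrightarrow>
     (\<exists>u. coprime u (int n) \<and> ([d = u\<^sup>2] (mod int n) \<or> [d = - (u\<^sup>2)] (mod int n)))"

lemma gauss_period_altdef:
  "gauss_period n S m = (\<Sum>d\<in>{0..<int n}. of_bool (S d) * zeta n (m * d))"
  unfolding gauss_period_def by (rule sum.mono_neutral_cong_left) auto

lemma gauss_period_cong:
  assumes "n > 0" "[a = b] (mod int n)"
  shows "gauss_period n S a = gauss_period n S b"
  unfolding gauss_period_def
  by (intro sum.cong zeta_cong cong_mult assms) auto

lemma gauss_period_0: "gauss_period n S 0 = of_nat (card {d. d \<in> {0..<int n} \<and> S d})"
  by (simp add: gauss_period_def)

text \<open>Powers of \<open>A\<close> act on the eigenvector by powers of \<open>x\<close>;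
  summability lets the finite sum over \<open>j\<close> pass through the exponential series.\<close>

lemma mat_exp_eigenvector:
  fixes A :: "complex mat"
  assumes A: "A \<in> carrier_mat n n" and i: "i < n"
    and ev: "\<And>i. i < n \<Longrightarrow> (\<Sum>j<n. A $$ (i, j) * v j) = x * v i"
  shows "(\<Sum>j<n. mat_exp A $$ (i, j) * v j) = exp x * v i"
proof -
  have pow: "(\<Sum>j<n. (A ^\<^sub>m k) $$ (i, j) * v j) = x ^ k * v i" for k
  proof (induction k)
    case 0
    have "(\<Sum>j<n. (A ^\<^sub>m 0) $$ (i, j) * v j) = (\<Sum>j<n. if j = i then v i else 0)"
      using A i by (intro sum.cong) auto
    then show ?case
      using i by simp
  next
    case (Suc k)
    have "(\<Sum>j<n. (A ^\<^sub>m Suc k) $$ (i, j) * v j)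
        = (\<Sum>j<n. \<Sum>l<n. (A ^\<^sub>m k) $$ (i, l) * A $$ (l, j) * v j)"
      using A i pow_carrier_mat[OF A, of k]
      by (intro sum.cong) (auto simp: scalar_prod_def atLeast0LessThan sum_distrib_right)
    also have "\<dots> = (\<Sum>l<n. (A ^\<^sub>m k) $$ (i, l) * (\<Sum>j<n. A $$ (l, j) * v j))"
      by (subst sum.swap) (simp add: sum_distrib_left mult_ac)
    also have "\<dots> = (\<Sum>l<n. (A ^\<^sub>m k) $$ (i, l) * (x * v l))"
      by (intro sum.cong) (auto simp: ev)
    also have "\<dots> = x * (\<Sum>l<n. (A ^\<^sub>m k) $$ (i, l) * v l)"
      by (simp add: sum_distrib_left mult_ac)
    also have "\<dots> = x ^ Suc k * v i"
      by (simp add: Suc)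
    finally show ?case .
  qed
  have sm: "summable (\<lambda>k. (A ^\<^sub>m k) $$ (i, j) / fact k)" if "j < n" for j
    using A i that by (rule summable_mat_exp)
  have "(\<Sum>j<n. mat_exp A $$ (i, j) * v j) = (\<Sum>j<n. \<Sum>k. (A ^\<^sub>m k) $$ (i, j) / fact k * v j)"
    using A i suminf_mult2[OF sm] by (intro sum.cong) (auto simp: mat_exp_def)
  also have "\<dots> = (\<Sum>k. \<Sum>j<n. (A ^\<^sub>m k) $$ (i, j) / fact k * v j)"
    using summable_mult2[OF sm] by (intro suminf_sum[symmetric]) simp
  also have "\<dots> = (\<Sum>k. (x ^ k /\<^sub>R fact k) * v i)"
  proof (rule suminf_cong)
    fix k
    have "(\<Sum>j<n. (A ^\<^sub>m k) $$ (i, j) / fact k * v j) = (\<Sum>j<n. (A ^\<^sub>m k) $$ (i, j) * v j) / fact k"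
      by (simp add: sum_divide_distrib)
    then show "(\<Sum>j<n. (A ^\<^sub>m k) $$ (i, j) / fact k * v j) = (x ^ k /\<^sub>R fact k) * v i"
      using pow[of k] by (simp add: scaleR_conv_of_real divide_inverse mult_ac)
  qed
  also have "\<dots> = exp x * v i"
    unfolding exp_def by (rule suminf_mult2[symmetric]) (rule summable_exp_generic)
  finally show ?thesis .
qed

section \<open>Connection set and eigenvalues of the circulant\<close>

lemma signed_unit_square_cong:
  "[a = b] (mod int n) \<Longrightarrow> signed_unit_square n a = signed_unit_square n b"
proof -
  assume ab: "[a = b] (mod int n)"
  have "[a = c] (mod int n) \<longleftrightarrow> [b = c] (mod int n)" for c
    using ab cong_sym cong_trans by blast
  then show ?thesis
    by (simp add: signed_unit_square_def)
qed

lemma signed_unit_square_minus: "signed_unit_square n (- a) \<longleftrightarrow> signed_unit_square n a"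
proof -
  have "[- a = b] (mod int n) \<longleftrightarrow> [a = - b] (mod int n)" for b
    using cong_minus_minus_iff[of "- a" b] by simp
  then show ?thesis
    unfolding signed_unit_square_def by auto
qed

lemma signed_unit_square_coprime:
  assumes "signed_unit_square n a"
  shows "coprime a (int n)"
proof -
  obtain u where u: "coprime u (int n)" "[a = u\<^sup>2] (mod int n) \<or> [a = - (u\<^sup>2)] (mod int n)"
    using assms by (auto simp: signed_unit_square_def)
  have "coprime (u\<^sup>2) (int n)" "coprime (- (u\<^sup>2)) (int n)"
    using u(1) by auto
  with u(2) show ?thesis
    using cong_imp_coprime cong_sym by blast
qed

lemma adjacent_iff:
  assumes "n > 1" "i < n" "j < n"
  shows "(i, j) \<in> parcs (quadratic_unitary_Cayley_graph n) \<longleftrightarrow> signed_unit_square n (int i - int j)"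
    (is "?L \<longleftrightarrow> ?R")
proof
  assume ?L
  then show ?R
    by (auto simp: quadratic_unitary_Cayley_graph_def signed_unit_square_def coprime_iff_gcd_eq_1)
next
  assume R: ?R
  then obtain u where u: "coprime u (int n)"
      "[int i - int j = u\<^sup>2] (mod int n) \<or> [int i - int j = - (u\<^sup>2)] (mod int n)"
    by (auto simp: signed_unit_square_def)
  define w where "w = u mod int n"
  have w: "[u = w] (mod int n)"
    by (simp add: w_def)
  have cop: "coprime w (int n)"
    using u(1) w cong_imp_coprime by blast
  have "w \<noteq> 0"
    using cop assms(1) by auto
  moreover have "w \<ge> 0" "w < int n"
    using assms(1) by (auto simp: w_def)
  ultimately have "1 \<le> w" "w \<le> int n - 1"
    by auto
  moreover have "[int i - int j = w\<^sup>2] (mod int n) \<or> [int i - int j = - (w\<^sup>2)] (mod int n)"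
  proof -
    have "[u\<^sup>2 = w\<^sup>2] (mod int n)" "[- (u\<^sup>2) = - (w\<^sup>2)] (mod int n)"
      using w by (simp_all add: cong_pow cong_minus_minus_iff)
    with u(2) show ?thesis
      using cong_trans by blast
  qed
  moreover have "i \<noteq> j"
    using signed_unit_square_coprime[OF R] assms(1) by auto
  ultimately show ?L
    using cop assms by (auto simp: quadratic_unitary_Cayley_graph_def coprime_iff_gcd_eq_1)
qed

abbreviation theta :: "nat \<Rightarrow> int \<Rightarrow> complex" where
  "theta n \<equiv> gauss_period n (signed_unit_square n)"

text \<open>Characters are eigenvectors of a circulant: the substitution \<open>d = j - i\<close>
  and a shift over a full period take out the factor \<open>zeta n (m * int i)\<close>. The symmetry
  of the connection set fixes the sign of the difference.\<close>

lemma adjacency_eigenvector: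
  assumes "n > 1" "i < n"
  shows "(\<Sum>j<n. adjacency_matrix (quadratic_unitary_Cayley_graph n) $$ (i, j) * zeta n (m * int j))
    = theta n m * zeta n (m * int i)"
proof -
  let ?f = "\<lambda>d. of_bool (signed_unit_square n d) * zeta n (m * (d + int i))"
  have "(\<Sum>j<n. adjacency_matrix (quadratic_unitary_Cayley_graph n) $$ (i, j) * zeta n (m * int j))
      = (\<Sum>j<n. of_bool (signed_unit_square n (int j - int i)) * zeta n (m * int j))"
  proof (rule sum.cong)
    fix j assume "j \<in> {..<n}"
    then show "adjacency_matrix (quadratic_unitary_Cayley_graph n) $$ (i, j) * zeta n (m * int j)
        = of_bool (signed_unit_square n (int j - int i)) * zeta n (m * int j)"
      using assms signed_unit_square_minus[of n "int j - int i"]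
      by (simp add: adjacency_matrix_quadratic_unitary_Cayley_graph adjacent_iff)
  qed simp
  also have "\<dots> = (\<Sum>d\<in>{0..<int n}. ?f (d + - int i))"
    by (rule sum.reindex_bij_witness[of _ nat int]) auto
  also have "\<dots> = (\<Sum>d\<in>{0..<int n}. ?f d)"
  proof (rule sum_periodic_shift)
    fix a b assume ab: "[a = b] (mod int n)"
    have "zeta n (m * (a + int i)) = zeta n (m * (b + int i))"
      using assms ab by (intro zeta_cong cong_mult cong_add) auto
    then show "?f a = ?f b"
      using signed_unit_square_cong[OF ab] by simp
  qed (use assms in auto)
  also have "\<dots> = theta n m * zeta n (m * int i)"
    unfolding gauss_period_altdef sum_distrib_right
    by (intro sum.cong) (auto simp: distrib_left zeta_add)
  finally show ?thesis .
qed

lemma transition_matrix_eigenvector: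
  assumes "n > 1" "i < n"
  shows "(\<Sum>j<n. transition_matrix (quadratic_unitary_Cayley_graph n) t $$ (i, j) * zeta n (m * int j))
    = exp (- \<i> * of_real t * theta n m) * zeta n (m * int i)"
  unfolding transition_matrix_def
proof (rule mat_exp_eigenvector[where n = n])
  let ?A = "adjacency_matrix (quadratic_unitary_Cayley_graph n)"
  show c: "(- \<i> * of_real t) \<cdot>\<^sub>m ?A \<in> carrier_mat n n"
    by (simp add: adjacency_matrix_quadratic_unitary_Cayley_graph)
  fix i assume i: "i < n"
  have "(\<Sum>j<n. ((- \<i> * of_real t) \<cdot>\<^sub>m ?A) $$ (i, j) * zeta n (m * int j))
      = (- \<i> * of_real t) * (\<Sum>j<n. ?A $$ (i, j) * zeta n (m * int j))"
    unfolding sum_distrib_left using i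
    by (intro sum.cong) (auto simp: adjacency_matrix_quadratic_unitary_Cayley_graph)
  then show "(\<Sum>j<n. ((- \<i> * of_real t) \<cdot>\<^sub>m ?A) $$ (i, j) * zeta n (m * int j))
      = - \<i> * of_real t * theta n m * zeta n (m * int i)"
    using adjacency_eigenvector[OF assms(1) i] by (simp add: mult_ac)
qed (use assms in auto)

text \<open>Every character is 1 at vertex 0, so row 0 of the transition matrix applied to it gives
  the eigenvalue on one side and \<open>\<gamma>\<close> on the other.\<close>

lemma periodic_graphD:
  assumes "n > 1" "periodic_graph (quadratic_unitary_Cayley_graph n)"
  obtains t \<gamma> where "t > 0" "\<And>m. exp (- \<i> * of_real t * theta n m) = \<gamma>"
proof -
  obtain t \<gamma> where t: "t > 0"
      and H: "transition_matrix (quadratic_unitary_Cayley_graph n) t = \<gamma> \<cdot>\<^sub>m 1\<^sub>m n"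
    using assms(2) by (auto simp: periodic_graph_def quadratic_unitary_Cayley_graph_def)
  have "exp (- \<i> * of_real t * theta n m) = \<gamma>" for m
  proof -
    have "(\<Sum>j<n. transition_matrix (quadratic_unitary_Cayley_graph n) t $$ (0, j) * zeta n (m * int j))
        = (\<Sum>j<n. if j = 0 then \<gamma> else 0)"
      using assms(1) unfolding H by (intro sum.cong) auto
    then show ?thesis
      using assms(1) transition_matrix_eigenvector[of n 0 t m] by simp
  qed
  with t that show ?thesis
    by blast
qed

text \<open>For integral \<open>theta\<close> the transition matrix at time \<open>2 * pi\<close>
  fixes every character, and the characters span.\<close>

lemma periodic_graphI:
  assumes "n > 1" "\<And>m. theta n m \<in> \<int>"
  shows "periodic_graph (quadratic_unitary_Cayley_graph n)"
proof -
  let ?H = "transition_matrix (quadratic_unitary_Cayley_graph n) (2 * pi)"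
  have e: "exp (- \<i> * of_real (2 * pi) * theta n m) = 1" for m
  proof -
    obtain k where "theta n m = of_int k"
      using assms(2) Ints_cases by blast
    then have "- \<i> * of_real (2 * pi) * theta n m = complex_of_real (of_int (2 * (- k)) * pi) * \<i>"
      by simp
    then show ?thesis
      unfolding exp_eq_1 by (auto intro!: exI[of _ "- k"])
  qed
  have "?H $$ (i, j) = of_bool (i = j)" if ij: "i < n" "j < n" for i j
  proof -
    have zz: "(\<Sum>m\<in>{0..<int n}. zeta n (m * (int k - int j))) = (if k = j then of_nat n else 0)"
      if "k < n" for k
    proof -
      have "int n dvd int k - int j \<longleftrightarrow> k = j"
      using that ij cong_less_modulus_unique_nat[of k j n]
      by (auto simp flip: cong_iff_dvd_diff simp: cong_int_iff)
      then show ?thesis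
        using sum_zeta[of n "int k - int j"] ij by (simp add: mult.commute)
    qed
    \<comment> \<open>Orthogonality expands the unit vector at \<open>j\<close> in characters, each
      of which \<open>?H\<close> fixes.\<close>
    have "of_nat n * ?H $$ (i, j) = (\<Sum>k<n. ?H $$ (i, k) * (\<Sum>m\<in>{0..<int n}. zeta n (m * (int k - int j))))"
      using ij by (simp add: zz if_distrib cong: if_cong)
    also have "\<dots> = (\<Sum>m\<in>{0..<int n}. zeta n (- (m * int j)) * (\<Sum>k<n. ?H $$ (i, k) * zeta n (m * int k)))"
      unfolding sum_distrib_left
      by (subst sum.swap) (intro sum.cong, auto simp: right_diff_distrib zeta_diff mult_ac)
    also have "\<dots> = (\<Sum>m\<in>{0..<int n}. zeta n (m * (int i - int j)))"
      using transition_matrix_eigenvector[OF assms(1) ij(1)] e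
      by (simp add: right_diff_distrib zeta_diff mult_ac)
    also have "\<dots> = of_nat n * of_bool (i = j)"
      using zz[OF ij(1)] by simp
    finally show ?thesis
      using ij by (simp split: if_splits)
  qed
  then have "?H = 1 \<cdot>\<^sub>m 1\<^sub>m n"
    by (intro eq_matI) (auto simp: transition_matrix_def mat_exp_def
         adjacency_matrix_quadratic_unitary_Cayley_graph)
  then show ?thesis
    unfolding periodic_graph_def
    by (intro exI[of _ "2 * pi"] exI[of _ 1]) (simp add: quadratic_unitary_Cayley_graph_def)
qed

section \<open>Integral periods\<close>

lemma finite_bounded_int_filter [simp]: "finite {d::int. 0 \<le> d \<and> d < N \<and> S d}"
  by (rule finite_subset[of _ "{0..<N}"]) auto

lemma zeta_int_span:
  assumes "n > 0"
  shows "zeta n k \<in> int_span (zeta n 1)"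
proof -
  have "zeta n k = zeta n 1 ^ nat (k mod int n)"
    using assms by (auto simp: zeta_power intro: zeta_cong)
  then show ?thesis
    by simp
qed

lemma gauss_period_int_span: "n > 0 \<Longrightarrow> gauss_period n S m \<in> int_span (zeta n 1)"
  unfolding gauss_period_def by (intro int_span_sum zeta_int_span)

text \<open>Elements of \<int>[w] for a root of unity \<open>w\<close> are algebraic integers, and a
  rational algebraic integer is an integer.\<close>

lemma int_span_zeta_Rats_Ints:
  assumes "n > 0" "x \<in> int_span (zeta n 1)" "x \<in> \<rat>"
  shows "x \<in> \<int>"
proof -
  have "zeta n 1 ^ n = 1"
    using assms(1) by (simp add: zeta_power zeta_eq_1_iff)
  then show ?thesis
    using assms int_span_algebraic_int rational_algebraic_int_is_int by blast
qed

text \<open>By this bound integral periods differ by at most \<open>2 * n\<close>, so congruence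
  modulo a prime above \<open>2 * n\<close> makes them equal.\<close>

lemma norm_gauss_period_le: "norm (gauss_period n S m) \<le> of_nat n"
proof -
  have "norm (gauss_period n S m) \<le> of_nat (card {d. d \<in> {0..<int n} \<and> S d})"
    unfolding gauss_period_def by (rule order_trans[OF norm_sum]) (simp add: zeta_def)
  also have "card {d. d \<in> {0..<int n} \<and> S d} \<le> card {0..<int n}"
    by (intro card_mono) auto
  finally show ?thesis
    by simp
qed

section \<open>Frobenius and the invariance of integral periods\<close>

lemma fermat_int:
  assumes "prime p"
  shows "int p dvd k ^ p - k"
proof (cases "int p dvd k")
  case True
  have "k dvd k ^ p"
    using assms prime_gt_0_nat by (simp add: dvd_power)
  then have "k dvd k ^ p - k"
    by simp
  with True show ?thesis
    by (rule dvd_trans)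
next
  case False
  define a where "a = nat (k mod int p)"
  have p: "p > 0"
    using assms prime_gt_0_nat by blast
  have a: "[k = int a] (mod int p)"
    using p by (simp add: a_def)
  have "\<not> p dvd a"
    using False cong_dvd_iff[OF a] by simp
  then have "[a ^ (p - 1) = 1] (mod p)"
    using assms fermat_theorem by blast
  then have "[a ^ (p - 1) * a = 1 * a] (mod p)"
    by (rule cong_scalar_right)
  then have "[a ^ p = a] (mod p)"
    using p by (simp flip: power_Suc2)
  then have "[int a ^ p = int a] (mod int p)"
    by (simp flip: cong_int_iff)
  moreover have "[k ^ p = int a ^ p] (mod int p)"
    using a by (rule cong_pow)
  ultimately have "[k ^ p = k] (mod int p)"
    using cong_trans[OF cong_trans cong_sym[OF a]] by blast
  then show ?thesis
    by (simp add: cong_iff_dvd_diff)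
qed

text \<open>
  Frobenius replaces the Galois action: modulo \<open>p\<close> the \<open>p\<close>-th power of a period is its
  \<open>p\<close>-th conjugate, and by Fermat it is also the period itself. The two integers then agree
  because they differ by less than \<open>p\<close>.
\<close>

lemma gauss_period_mult_prime:
  assumes "n > 0" "prime p" "p > 2 * n" and int: "\<And>m. gauss_period n S m \<in> \<int>"
  shows "gauss_period n S (m * int p) = gauss_period n S m"
proof -
  obtain a where a: "gauss_period n S m = of_int a"
    using int Ints_cases by blast
  obtain b where b: "gauss_period n S (m * int p) = of_int b"
    using int Ints_cases by blast
  have zp: "zeta n (m * d) ^ p = zeta n (m * int p * d)" for d
    by (simp add: zeta_power mult_ac)
  obtain r where r: "r \<in> int_span (zeta n 1)"
      "gauss_period n S m ^ p = gauss_period n S (m * int p) + of_nat p * r"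
    using int_span_sum_power_prime[OF assms(2), of "{d. d \<in> {0..<int n} \<and> S d}" "\<lambda>d. zeta n (m * d)" "zeta n 1"]
      zeta_int_span[OF assms(1)]
    by (auto simp: gauss_period_def zp)
  have p: "p > 0"
    using assms by auto
  \<comment> \<open>The error term is rational and lies in \<int>[w], so it is an integer; the
    equation becomes a congruence of integers modulo \<open>p\<close>.\<close>
  have "r = of_int (a ^ p - b) / of_int (int p)"
    using r(2) p by (simp add: a b field_simps)
  then have "r \<in> \<rat>"
    by (simp only: Rats_divide Rats_of_int)
  then obtain c where c: "r = of_int c"
    using int_span_zeta_Rats_Ints[OF assms(1) r(1)] Ints_cases by blast
  have "of_int (a ^ p) = (of_int (b + int p * c) :: complex)"
    using r(2) by (simp add: a b c)
  then have "a ^ p = b + int p * c"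
    by (simp only: of_int_eq_iff)
  then have "int p dvd (a ^ p - b)"
    by simp
  then have "int p dvd (a ^ p - b) - (a ^ p - a)"
    using fermat_int[OF assms(2)] by (rule dvd_diff)
  then have dvd: "int p dvd a - b"
    by simp
  have "\<bar>a\<bar> \<le> int n" "\<bar>b\<bar> \<le> int n"
    using norm_gauss_period_le[of n S m] norm_gauss_period_le[of n S "m * int p"]
    unfolding a b by (simp_all add: abs_if split: if_splits)
  then have "\<bar>a - b\<bar> < int p"
    using assms(3) by linarith
  with dvd have "a = b"
    using zdvd_not_zless[of "\<bar>a - b\<bar>" "int p"] by auto
  then show ?thesis
    by (simp add: a b)
qed

text \<open>The prime factors of \<open>N\<close> are stripped one at a time, each large enough for
  the invariance under a single prime.\<close>

lemma gauss_period_mult_rough: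
  assumes "n > 0" "N > 0" and rough: "\<And>p. prime p \<Longrightarrow> p dvd N \<Longrightarrow> p > 2 * n"
    and int: "\<And>m. gauss_period n S m \<in> \<int>"
  shows "gauss_period n S (m * int N) = gauss_period n S m"
  using assms(2,3)
proof (induction N arbitrary: m rule: prime_divisors_induct)
  case (factor p N)
  then show ?case
    using gauss_period_mult_prime[OF assms(1) _ _ int, of p "m * int N"]
    by (simp add: mult_ac)
qed auto

text \<open>\<open>N\<close> is congruent to \<open>1\<close> modulo the small primes not dividing \<open>n\<close>.\<close>

lemma ex_rough_cong:
  fixes n B :: nat and a :: int
  assumes "n > 0" "coprime a (int n)"
  obtains N :: nat where "N > 0" "[int N = a] (mod int n)"
    "\<And>p. prime p \<Longrightarrow> p dvd N \<Longrightarrow> p > B"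
proof -
  define Q where "Q = (\<Prod>p | prime p \<and> p \<le> B \<and> \<not> p dvd n. p)"
  have fin: "finite {p. prime p \<and> p \<le> B \<and> \<not> p dvd n}"
    by simp
  have "coprime n Q"
    unfolding Q_def using prime_imp_coprime by (intro prod_coprime_right) (auto simp: coprime_commute)
  have Q: "Q > 0"
    unfolding Q_def using prime_gt_0_nat by (intro prod_pos) auto
  obtain x where x: "[x = nat (a mod int n)] (mod n)" "[x = 1] (mod Q)"
    using binary_chinese_remainder_nat[OF \<open>coprime n Q\<close>] by blast
  \<comment> \<open>Adding \<open>n * Q\<close> keeps both congruences and makes \<open>N\<close>
    positive even if \<open>x = 0\<close>.\<close>
  define N where "N = x + n * Q"
  have N: "[N = nat (a mod int n)] (mod n)" "[N = 1] (mod Q)"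
    using x by (simp_all add: N_def unique_euclidean_semiring_class.cong_def)
  have "[int N = int (nat (a mod int n))] (mod int n)"
    using N(1) by (simp only: cong_int_iff)
  then have Na: "[int N = a] (mod int n)"
    using assms by simp
  show ?thesis
  proof (rule that[OF _ Na])
    show "N > 0"
      using Q assms by (simp add: N_def)
  next
    fix p assume p: "prime p" "p dvd N"
    show "p > B"
    proof (rule ccontr)
      assume "\<not> p > B"
      \<comment> \<open>A prime up to \<open>B\<close> divides either \<open>n\<close>, to which
        \<open>N\<close> is coprime, or \<open>Q\<close>, modulo which \<open>N\<close> is
        1.\<close>
      show False
      proof (cases "p dvd n")
        case True
        have "coprime N n"
          using cong_imp_coprime[OF cong_sym[OF Na] assms(2)] by simp
        with True p show False
          using coprime_common_divisor_nat[of N n p] by simp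
      next
        case False
        then have "p dvd Q"
          unfolding Q_def using p \<open>\<not> p > B\<close> by (intro dvd_prodI[OF fin]) auto
        then have "[N = 1] (mod p)"
          using N(2) cong_dvd_modulus_nat by blast
        with p show False
          using cong_dvd_iff[of N 1 p] by simp
      qed
    qed
  qed
qed

text \<open>Replacing \<open>a\<close> by a rough number in its class shows that multiplication by
  \<open>a\<close> fixes the periods. By Fourier inversion \<open>a * d = 1\<close> then has as many
  solutions in \<open>S\<close> as \<open>1 * d = 1\<close>, and the latter has one because of
  \<open>S 1\<close>.\<close>

lemma gauss_period_integral_invariant:
  assumes "n > 0" and int: "\<And>m. gauss_period n S m \<in> \<int>" and S1: "S 1"
    and S_cong: "\<And>a b. [a = b] (mod int n) \<Longrightarrow> S a = S b"
    and a: "coprime a (int n)"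
  shows "\<exists>d. S d \<and> [a * d = 1] (mod int n)"
proof -
  obtain N where N: "N > 0" "[int N = a] (mod int n)" "\<And>p. prime p \<Longrightarrow> p dvd N \<Longrightarrow> p > 2 * n"
    using ex_rough_cong[OF assms(1) a] by blast
  have am: "gauss_period n S (m * a) = gauss_period n S m" for m
    using gauss_period_cong[OF assms(1), of "m * a" "m * int N" S] N
      gauss_period_mult_rough[OF assms(1) N(1,3) int]
    by (auto intro: cong_scalar_left cong_sym)
  have inv: "(\<Sum>m\<in>{0..<int n}. gauss_period n S (m * c) * zeta n (- m))
      = of_nat n * of_nat (card {d. d \<in> {0..<int n} \<and> S d \<and> [c * d = 1] (mod int n)})" for c
  proof -
    have "(\<Sum>m\<in>{0..<int n}. gauss_period n S (m * c) * zeta n (- m))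
        = (\<Sum>d | d \<in> {0..<int n} \<and> S d. \<Sum>m\<in>{0..<int n}. zeta n ((c * d - 1) * m))"
      unfolding gauss_period_def sum_distrib_right
      by (subst sum.swap) (intro sum.cong, auto simp: algebra_simps simp flip: zeta_add)
    also have "\<dots> = (\<Sum>d | d \<in> {0..<int n} \<and> S d. if [c * d = 1] (mod int n) then of_nat n else 0)"
      using assms(1) by (simp add: sum_zeta cong_iff_dvd_diff)
    also have "\<dots> = of_nat n * of_nat (card {d. d \<in> {0..<int n} \<and> S d \<and> [c * d = 1] (mod int n)})"
      by (subst sum.inter_filter[symmetric]) (auto simp: conj_assoc mult.commute)
    finally show ?thesis .
  qed
  \<comment> \<open>For \<open>n = 1\<close> the representative of 1 is 0, hence the
    reduction.\<close>
  have "1 mod int n \<in> {d. d \<in> {0..<int n} \<and> S d \<and> [1 * d = 1] (mod int n)}"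
    using assms(1) S1 S_cong[of "1 mod int n" 1] by simp
  then have "card {d. d \<in> {0..<int n} \<and> S d \<and> [1 * d = 1] (mod int n)} > 0"
    by (subst card_gt_0_iff) auto
  moreover have "card {d. d \<in> {0..<int n} \<and> S d \<and> [a * d = 1] (mod int n)}
      = card {d. d \<in> {0..<int n} \<and> S d \<and> [1 * d = 1] (mod int n)}"
    using inv[of 1] inv[of a] am assms(1) by (simp only: mult_1_right) simp
  ultimately have "card {d. d \<in> {0..<int n} \<and> S d \<and> [a * d = 1] (mod int n)} > 0"
    by (simp only:)
  then have "{d. d \<in> {0..<int n} \<and> S d \<and> [a * d = 1] (mod int n)} \<noteq> {}"
    by (simp only: card_gt_0_iff) simp
  then show ?thesis
    by blast
qed

section \<open>Periodicity makes every unit a signed square\<close>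

lemma signed_unit_square_1: "signed_unit_square n 1"
  using cong_refl[of 1 "int n"] unfolding signed_unit_square_def by (intro exI[of _ 1]) simp

lemma signed_unit_square_mult:
  assumes "signed_unit_square n a" "signed_unit_square n b"
  shows "signed_unit_square n (a * b)"
proof -
  obtain u where u: "coprime u (int n)" "[a = u\<^sup>2] (mod int n) \<or> [a = - (u\<^sup>2)] (mod int n)"
    using assms(1) unfolding signed_unit_square_def by blast
  obtain v where v: "coprime v (int n)" "[b = v\<^sup>2] (mod int n) \<or> [b = - (v\<^sup>2)] (mod int n)"
    using assms(2) unfolding signed_unit_square_def by blast
  have "[a * b = u\<^sup>2 * v\<^sup>2] (mod int n) \<or> [a * b = - (u\<^sup>2 * v\<^sup>2)] (mod int n)"
    using u(2) v(2) cong_mult[of a "u\<^sup>2" "int n" b "v\<^sup>2"] cong_mult[of a "- (u\<^sup>2)" "int n" b "v\<^sup>2"]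
      cong_mult[of a "u\<^sup>2" "int n" b "- (v\<^sup>2)"] cong_mult[of a "- (u\<^sup>2)" "int n" b "- (v\<^sup>2)"]
    unfolding mult_minus_left mult_minus_right minus_minus by blast
  moreover have "coprime (u * v) (int n)"
    using u(1) v(1) by simp
  ultimately show ?thesis
    unfolding signed_unit_square_def power_mult_distrib[symmetric] by blast
qed

lemma signed_unit_square_square: "coprime a (int n) \<Longrightarrow> signed_unit_square n (a\<^sup>2)"
  unfolding signed_unit_square_def using cong_refl by blast

lemma periodic_imp_all_units:
  assumes n: "n > 1" and per: "periodic_graph (quadratic_unitary_Cayley_graph n)"
    and a: "coprime a (int n)"
  shows "signed_unit_square n a"
proof -
  have n0: "n > 0"
    using n by simp
  obtain t \<gamma> where t: "t > 0" and e: "\<And>m. exp (- \<i> * of_real t * theta n m) = \<gamma>"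
    using periodic_graphD[OF n per] by blast
  define c where "c = card {d. d \<in> {0..<int n} \<and> signed_unit_square n d}"
  have "1 \<in> {d. d \<in> {0..<int n} \<and> signed_unit_square n d}"
    using n signed_unit_square_1 by simp
  then have c: "c > 0"
    unfolding c_def card_gt_0_iff by (intro conjI) (blast, simp)
  have theta0: "theta n 0 = of_nat c"
    by (simp add: gauss_period_0 c_def)
  \<comment> \<open>Comparison with \<open>m = 0\<close>, whose eigenvalue is the degree
    \<open>c\<close>, eliminates \<open>\<gamma>\<close>.\<close>
  have "\<exists>k::int. of_real t * (theta n m - of_nat c) = of_int k * (2 * of_real pi)" for m
  proof -
    have "exp (- \<i> * of_real t * theta n m) = exp (- \<i> * of_real t * theta n 0)"
      by (simp only: e)
    then obtain k :: int where
      "- \<i> * of_real t * theta n m = - \<i> * of_real t * theta n 0 + (of_int (2 * k) * pi) * \<i>"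
      unfolding exp_eq by blast
    then have "\<i> * (of_real t * (theta n m - of_nat c)) = \<i> * (of_int (- k) * (2 * of_real pi))"
      by (simp add: theta0 algebra_simps)
    then show ?thesis
      by (subst (asm) mult_left_cancel) (rule complex_i_not_zero, rule exI)
  qed
  then obtain k :: "int \<Rightarrow> int" where
    k: "\<And>m. of_real t * (theta n m - of_nat c) = of_int (k m) * (2 * of_real pi)"
    by metis
  text \<open>The graph has no loops, so its eigenvalues sum to \<open>0\<close>; this makes \<open>t / pi\<close> rational.\<close>
  have trace: "(\<Sum>m\<in>{0..<int n}. theta n m) = 0"
  proof -
    have "(\<Sum>m\<in>{0..<int n}. theta n m)
        = (\<Sum>d | d \<in> {0..<int n} \<and> signed_unit_square n d. \<Sum>m\<in>{0..<int n}. zeta n (d * m))"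
      unfolding gauss_period_def by (subst sum.swap) (simp add: mult.commute)
    also have "\<dots> = 0"
    proof (rule sum.neutral, rule ballI)
      fix d assume "d \<in> {d. d \<in> {0..<int n} \<and> signed_unit_square n d}"
      then have "coprime d (int n)"
        using signed_unit_square_coprime by blast
      then have "\<not> int n dvd d"
        using n coprime_common_divisor[of d "int n" "int n"] by auto
      then show "(\<Sum>m\<in>{0..<int n}. zeta n (d * m)) = 0"
        using n by (simp add: sum_zeta)
    qed
    finally show ?thesis .
  qed
  define K where "K = (\<Sum>m\<in>{0..<int n}. k m)"
  have "of_int K * (2 * of_real pi) = (\<Sum>m\<in>{0..<int n}. of_real t * (theta n m - of_nat c))"
    by (simp add: k K_def sum_distrib_right)
  also have "\<dots> = - (of_real t * of_nat n * of_nat c)"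
    by (simp add: trace sum_subtractf flip: sum_distrib_left)
  finally have K: "of_int K * (2 * of_real pi) = - (of_real t * of_nat n * of_nat c :: complex)" .
  have "K \<noteq> 0"
    using K t n c by auto
  \<comment> \<open>Dividing the relation for \<open>m\<close> by the summed one cancels both
    \<open>t\<close> and \<open>pi\<close>, which leaves a rational value.\<close>
  have "theta n m = of_nat c - of_int (k m) * of_nat n * of_nat c / of_int K" for m
  proof -
    have "of_real t * (theta n m - of_nat c) * of_int K = of_int (k m) * (of_int K * (2 * of_real pi))"
      by (simp add: k)
    also have "\<dots> = of_real t * (- (of_int (k m) * of_nat n * of_nat c))"
      unfolding K by simp
    finally have "of_real t * ((theta n m - of_nat c) * of_int K)
        = of_real t * (- (of_int (k m) * of_nat n * of_nat c))"
      by (simp only: mult.assoc)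
    moreover have "complex_of_real t \<noteq> 0"
      using t by simp
    ultimately have "(theta n m - of_nat c) * of_int K = - (of_int (k m) * of_nat n * of_nat c)"
      by (auto simp only: mult_cancel_left)
    then show ?thesis
      using \<open>K \<noteq> 0\<close> by (simp add: field_simps)
  qed
  then have "theta n m \<in> \<rat>" for m
    by simp
  then have int: "theta n m \<in> \<int>" for m
    by (rule int_span_zeta_Rats_Ints[OF n0 gauss_period_int_span[OF n0]])
  obtain d where d: "signed_unit_square n d" "[a * d = 1] (mod int n)"
    using gauss_period_integral_invariant[OF n0 int signed_unit_square_1 signed_unit_square_cong a] by blast
  \<comment> \<open>Only the inverse \<open>d\<close> of \<open>a\<close> is known to be a signed
    square so far; \<open>a\<close> is congruent to the product of \<open>d\<close> and the square
    \<open>a\<^sup>2\<close>.\<close>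
  have "[a * (a * d) = a * 1] (mod int n)"
    using d(2) by (rule cong_scalar_left)
  then have "[a\<^sup>2 * d = a] (mod int n)"
    by (simp add: power2_eq_square mult_ac)
  moreover have "signed_unit_square n (a\<^sup>2 * d)"
    using d(1) a by (intro signed_unit_square_mult signed_unit_square_square)
  ultimately show ?thesis
    using signed_unit_square_cong[of "a\<^sup>2 * d" a n] by (simp only:)
qed

section \<open>Moduli whose units are squares up to sign\<close>

definition units_signed_squares :: "nat \<Rightarrow> bool" where
  "units_signed_squares n \<longleftrightarrow> (\<forall>a. coprime a (int n) \<longrightarrow> signed_unit_square n a)"

text \<open>These are Ramanujan sums. Sorting the full character sum by the reduced denominator of
  \<open>k / n\<close> splits it into the sums for all divisors of \<open>n\<close>. The full sum is
  \<open>n\<close> or 0, and induction covers the proper divisors.\<close>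

lemma gauss_period_coprime_Ints:
  assumes "n > 0"
  shows "gauss_period n (\<lambda>d. coprime d (int n)) m \<in> \<int>"
  using assms
proof (induction n rule: less_induct)
  case (less n)
  \<comment> \<open>The denominator of \<open>k / n\<close> in lowest terms; \<open>k = 0\<close>
    gets denominator 1.\<close>
  define g where "g = (\<lambda>k. n div gcd (nat k) n)"
  have "(\<Sum>k\<in>{0..<int n}. zeta n (m * k))
      = (\<Sum>d\<in>{d. d dvd n}. \<Sum>k | k \<in> {0..<int n} \<and> g k = d. zeta n (m * k))"
  proof (rule sum.group[symmetric])
    have "n div gcd (nat k) n dvd n" for k
      by (metis dvd_div_mult_self dvd_triv_left gcd_dvd2)
    then show "g ` {0..<int n} \<subseteq> {d. d dvd n}"
      by (auto simp: g_def)
  qed (use less.prems in auto)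
  also have "\<dots> = (\<Sum>d\<in>{d. d dvd n}. gauss_period d (\<lambda>k. coprime k (int d)) m)"
  proof (rule sum.cong)
    fix d assume "d \<in> {d. d dvd n}"
    then obtain c where n: "n = d * c"
      by auto
    have pos: "d > 0" "c > 0"
      using n less.prems by auto
    have mem: "g k = d \<longleftrightarrow> gcd (nat k) n = c" for k
    proof
      assume "g k = d"
      then have "d * gcd (nat k) n = n"
        unfolding g_def using less.prems by (metis dvd_div_mult_self gcd_dvd2)
      then show "gcd (nat k) n = c"
        using n pos by simp
    qed (use n pos in \<open>simp add: g_def\<close>)
    show "(\<Sum>k | k \<in> {0..<int n} \<and> g k = d. zeta n (m * k)) = gauss_period d (\<lambda>k. coprime k (int d)) m"
      unfolding gauss_period_def
    proof (rule sum.reindex_bij_witness[of _ "\<lambda>k. k * int c" "\<lambda>k. k div int c"])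
      fix k assume "k \<in> {k. k \<in> {0..<int n} \<and> g k = d}"
      then have k: "0 \<le> k" "k < int n" "gcd (nat k) n = c"
        by (auto simp: mem)
      then have "int c dvd k"
        by (metis gcd_dvd1 int_dvd_int_iff nat_0_le)
      then obtain j where j: "k = j * int c"
        by (metis dvd_def mult.commute)
      have j0: "0 \<le> j" "j < int d"
        using k j pos by (auto simp: n zero_le_mult_iff)
      have "nat k = nat j * c"
        using j0 by (simp add: j nat_mult_distrib)
      then have "gcd (nat j) d = 1"
        using k(3) pos by (simp add: n gcd_mult_distrib_nat mult.commute flip: gcd_mult_distrib_nat)
      then have "coprime (nat j) d"
        by (simp only: coprime_iff_gcd_eq_1)
      then have "coprime (int (nat j)) (int d)"
        by (simp only: coprime_int_iff)
      then show "k div int c \<in> {k. k \<in> {0..<int d} \<and> coprime k (int d)}"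
        using j j0 pos by simp
      show "k div int c * int c = k"
        using j pos by simp
      show "zeta d (m * (k div int c)) = zeta n (m * k)"
        using j pos by (simp add: n zeta_def mult.assoc)
    next
      fix j assume "j \<in> {k. k \<in> {0..<int d} \<and> coprime k (int d)}"
      then have j: "0 \<le> j" "j < int d" "coprime j (int d)"
        by auto
      show "j * int c div int c = j"
        using pos by simp
      have "coprime (int (nat j)) (int d)"
        using j by simp
      then have "coprime (nat j) d"
        by (simp only: coprime_int_iff)
      then have "gcd (nat j) d = 1"
        by (simp only: coprime_iff_gcd_eq_1)
      then have "gcd (nat (j * int c)) n = c"
        using j by (simp add: n nat_mult_distrib mult.commute flip: gcd_mult_distrib_nat)
      then show "j * int c \<in> {k. k \<in> {0..<int n} \<and> g k = d}"
        using j pos by (simp add: mem) (simp add: n)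
    qed
  qed simp
  also have "{d. d dvd n} = insert n {d. d dvd n \<and> d < n}"
    using less.prems dvd_imp_le by fastforce
  finally have "gauss_period n (\<lambda>d. coprime d (int n)) m
      = (\<Sum>k\<in>{0..<int n}. zeta n (m * k))
        - (\<Sum>d\<in>{d. d dvd n \<and> d < n}. gauss_period d (\<lambda>k. coprime k (int d)) m)"
    using less.prems by simp
  moreover have "(\<Sum>k\<in>{0..<int n}. zeta n (m * k)) \<in> \<int>"
    using less.prems by (simp add: sum_zeta)
  moreover have "(\<Sum>d\<in>{d. d dvd n \<and> d < n}. gauss_period d (\<lambda>k. coprime k (int d)) m) \<in> \<int>"
    using less by (intro Ints_sum) (auto intro: dvd_pos_nat)
  ultimately show ?case
    by simp
qed

lemma periodic_iff_units_signed_squares: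
  assumes "n > 1"
  shows "periodic_graph (quadratic_unitary_Cayley_graph n) \<longleftrightarrow> units_signed_squares n"
proof
  assume "units_signed_squares n"
  then have "signed_unit_square n = (\<lambda>d. coprime d (int n))"
    using signed_unit_square_coprime by (auto simp: units_signed_squares_def fun_eq_iff)
  then show "periodic_graph (quadratic_unitary_Cayley_graph n)"
    using assms gauss_period_coprime_Ints[of n] by (intro periodic_graphI) simp_all
qed (use assms periodic_imp_all_units in \<open>auto simp: units_signed_squares_def\<close>)

text \<open>A unit modulo \<open>d\<close> need not be one modulo \<open>n\<close>, but a
  representative with all prime factors above \<open>n\<close> is; its signed square root modulo
  \<open>n\<close> also serves modulo \<open>d\<close>.\<close>

lemma units_signed_squares_dvd:
  assumes "units_signed_squares n" "d dvd n" "n > 0"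
  shows "units_signed_squares d"
  unfolding units_signed_squares_def
proof (intro allI impI)
  fix a assume a: "coprime a (int d)"
  have d: "d > 0"
    using assms dvd_pos_nat by blast
  obtain N where N: "N > 0" "[int N = a] (mod int d)" "\<And>p. prime p \<Longrightarrow> p dvd N \<Longrightarrow> p > n"
    using ex_rough_cong[OF d a] by metis
  have "coprime N n"
  proof (rule ccontr)
    assume "\<not> coprime N n"
    then obtain p where "prime p" "p dvd gcd N n"
      using prime_factor_nat by (metis coprime_iff_gcd_eq_1)
    then have "prime p" "p dvd N" "p dvd n"
      by auto
    with N(3) assms(3) show False
      by (meson dvd_imp_le leD)
  qed
  then have "signed_unit_square n (int N)"
    using assms(1) by (simp add: units_signed_squares_def)
  then obtain u where u: "coprime u (int n)" "[int N = u\<^sup>2] (mod int n) \<or> [int N = - (u\<^sup>2)] (mod int n)"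
    by (auto simp: signed_unit_square_def)
  have "[int N = u\<^sup>2] (mod int d) \<or> [int N = - (u\<^sup>2)] (mod int d)"
    using u(2) assms(2) cong_dvd_modulus int_dvd_int_iff by blast
  moreover have "coprime u (int d)"
    using u(1) assms(2) by (meson coprime_divisors dvd_refl int_dvd_int_iff)
  ultimately have "signed_unit_square d (int N)"
    by (auto simp: signed_unit_square_def)
  then show "signed_unit_square d a"
    using signed_unit_square_cong[OF N(2)] by simp
qed

section \<open>Obstructions to signed square roots\<close>

lemma units_signed_squaresD:
  assumes "units_signed_squares n" "coprime a (int n)"
  obtains u where "[a = u\<^sup>2] (mod int n) \<or> [a = - (u\<^sup>2)] (mod int n)"
  using assms by (auto simp: units_signed_squares_def signed_unit_square_def)

text \<open>Squaring identifies 1 and -1, so on the finite set of nonzero residues it is not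
  injective and hence not surjective.\<close>

lemma ex_not_QuadRes:
  assumes "prime p" "odd p"
  obtains g where "\<not> QuadRes (int p) g" "\<not> int p dvd g"
proof -
  have p2: "p > 2"
    using assms prime_gt_1_nat by (metis One_nat_def Suc_lessI dvd_refl numeral_2_eq_2)
  define f where "f = (\<lambda>x::int. x\<^sup>2 mod int p)"
  have "f 1 = f (int p - 1)" "1 \<noteq> int p - 1" "1 \<in> {1..<int p}" "int p - 1 \<in> {1..<int p}"
  proof -
    have "(int p - 1)\<^sup>2 = 1 + int p * (int p - 2)"
      by (simp add: power2_eq_square algebra_simps)
    then show "f 1 = f (int p - 1)"
      by (simp add: f_def)
  qed (use p2 in auto)
  then have "\<not> inj_on f {1..<int p}"
    unfolding inj_on_def by blast
  then have "\<not> {1..<int p} \<subseteq> f ` {1..<int p}"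
    using endo_inj_surj finite_surj_inj[of "{1..<int p}" f] by blast
  then obtain g where g: "g \<in> {1..<int p}" "g \<notin> f ` {1..<int p}"
    by blast
  have ndvd: "\<not> int p dvd g"
    using g(1) zdvd_not_zless by auto
  have "\<not> QuadRes (int p) g"
  proof
    assume "QuadRes (int p) g"
    then obtain y where y: "[y\<^sup>2 = g] (mod int p)"
      by (auto simp: QuadRes_def)
    have fy: "f (y mod int p) = g"
      using y g(1) by (simp add: f_def unique_euclidean_semiring_class.cong_def power_mod)
    have "y mod int p \<noteq> 0"
      using y ndvd by (metis cong_dvd_iff dvd_eq_mod_eq_0 dvd_power zero_less_numeral dvd_trans)
    moreover have "0 \<le> y mod int p" "y mod int p < int p"
      using p2 by simp_all
    ultimately have "y mod int p \<in> {1..<int p}"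
      by simp
    then show False
      using g(2) fy by blast
  qed
  with ndvd show ?thesis
    using that by blast
qed

text \<open>Odd squares are 1 modulo 8, so the unit 3 is no square up to sign.\<close>

lemma not_units_signed_squares_8: "\<not> units_signed_squares 8"
proof
  assume "units_signed_squares 8"
  moreover have "coprime 3 (int 8)"
    by (simp add: coprime_iff_gcd_eq_1) (code_simp)
  ultimately obtain u where "[3 = u\<^sup>2] (mod int 8) \<or> [3 = - (u\<^sup>2)] (mod int 8)"
    by (rule units_signed_squaresD)
  then have "u\<^sup>2 mod 8 = 3 \<or> (- (u\<^sup>2)) mod 8 = 3"
    by (auto simp: unique_euclidean_semiring_class.cong_def)
  moreover have "w mod 8 = 5" if "- w mod 8 = 3" for w :: int
    using that by presburger
  ultimately have "u\<^sup>2 mod 8 \<in> {3, 5}"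
    by blast
  then have "(u mod 8)\<^sup>2 mod 8 \<in> {3, 5}"
    by (simp add: power_mod)
  moreover have "u mod 8 \<in> {0..<8}"
    by simp
  then have "u mod 8 \<in> {0, 1, 2, 3, 4, 5, 6, 7}"
    by (simp; presburger?)
  ultimately show False
    by auto
qed

lemma not_QuadResD: "\<not> QuadRes m g \<Longrightarrow> \<not> [g = u\<^sup>2] (mod m)"
  unfolding QuadRes_def using cong_sym by blast

text \<open>One sign has to serve both factors. A nonsquare at one factor and 1 at the other force
  the negative sign; doing this both ways and multiplying makes \<open>g1\<close> a square modulo
  \<open>m1\<close>.\<close>

lemma not_units_signed_squares_mult:
  assumes cop: "coprime m1 m2" and pos: "m1 > 0" "m2 > 0"
    and g1: "coprime g1 (int m1)" "\<not> QuadRes (int m1) g1"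
    and g2: "coprime g2 (int m2)" "\<not> QuadRes (int m2) g2"
  shows "\<not> units_signed_squares (m1 * m2)"
proof
  assume uss: "units_signed_squares (m1 * m2)"
  have ex: "\<exists>u. ([a = u\<^sup>2] (mod int m1) \<and> [b = u\<^sup>2] (mod int m2)) \<or>
               ([a = - (u\<^sup>2)] (mod int m1) \<and> [b = - (u\<^sup>2)] (mod int m2))"
    if ab: "coprime a (int m1)" "coprime b (int m2)" for a b
  proof -
    have "coprime (int m1) (int m2)"
      using cop by simp
    then obtain x where x: "[x = a] (mod int m1)" "[x = b] (mod int m2)"
      using binary_chinese_remainder_int by blast
    have "coprime x (int m1)" "coprime x (int m2)"
      using cong_imp_coprime[OF cong_sym[OF x(1)] ab(1)] cong_imp_coprime[OF cong_sym[OF x(2)] ab(2)] .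
    then have "coprime x (int (m1 * m2))"
      by simp
    with uss obtain u where u: "[x = u\<^sup>2] (mod int (m1 * m2)) \<or> [x = - (u\<^sup>2)] (mod int (m1 * m2))"
      by (rule units_signed_squaresD)
    have "[a = c] (mod int m1) \<and> [b = c] (mod int m2)" if "[x = c] (mod int (m1 * m2))" for c
      using that cong_trans[OF cong_sym[OF x(1)]] cong_trans[OF cong_sym[OF x(2)]]
        cong_modulus_mult[of x c "int m1" "int m2"] cong_modulus_mult[of x c "int m2" "int m1"]
      by (simp add: mult.commute)
    with u show ?thesis
      by blast
  qed
  obtain u where u: "[g1 = - (u\<^sup>2)] (mod int m1)" "[1 = - (u\<^sup>2)] (mod int m2)"
    using ex[OF g1(1), of 1] not_QuadResD[OF g1(2)] coprime_1_left by blast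
  obtain v where v: "[1 = - (v\<^sup>2)] (mod int m1)" "[g2 = - (v\<^sup>2)] (mod int m2)"
    using ex[OF _ g2(1), of 1] not_QuadResD[OF g2(2)] coprime_1_left by blast
  have "[g1 * 1 = - (u\<^sup>2) * - (v\<^sup>2)] (mod int m1)"
    using u(1) v(1) by (rule cong_mult)
  then have "[g1 = (u * v)\<^sup>2] (mod int m1)"
    by (simp add: power_mult_distrib)
  with not_QuadResD[OF g1(2)] show False
    by blast
qed

text \<open>If \<open>p\<close> is 1 modulo 4, then -1 is a square, so a signed square is a square
  and a nonresidue gives a contradiction.\<close>

lemma units_signed_squares_prime_cong_3:
  assumes "prime p" "odd p" "units_signed_squares p"
  shows "[p = 3] (mod 4)"
proof (rule ccontr)
  assume "[p \<noteq> 3] (mod 4)"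
  then have p1: "p mod 4 = 1"
    using assms(2) unfolding unique_euclidean_semiring_class.cong_def by simp presburger
  have p2: "p > 2"
    using assms prime_ge_2_nat[of p] by (cases "p = 2") auto
  have "even ((p - 1) div 2)"
    using p1 by presburger
  then have "[Legendre (- 1) (int p) = 1] (mod int p)"
    using euler_criterion[OF assms(1) p2, of "- 1"] by simp
  \<comment> \<open>The possible values 0, 1 and -1 are distinct modulo
    \<open>p > 2\<close>.\<close>
  then have "Legendre (- 1) (int p) = 1"
    using p2 by (auto simp: Legendre_def cong_iff_dvd_diff zdvd_not_zless split: if_splits)
  then obtain y where y: "[y\<^sup>2 = - 1] (mod int p)"
    by (auto simp: Legendre_def QuadRes_def split: if_splits)
  obtain g where g: "\<not> QuadRes (int p) g" "\<not> int p dvd g"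
    using ex_not_QuadRes[OF assms(1,2)] .
  have "coprime g (int p)"
    using g(2) assms(1) prime_imp_coprime[of "int p" g] coprime_commute[of g "int p"] by simp
  with assms(3) obtain u where "[g = u\<^sup>2] (mod int p) \<or> [g = - (u\<^sup>2)] (mod int p)"
    by (rule units_signed_squaresD)
  then show False
  proof
    assume "[g = u\<^sup>2] (mod int p)"
    with not_QuadResD[OF g(1)] show False
      by blast
  next
    assume "[g = - (u\<^sup>2)] (mod int p)"
    moreover have "[y\<^sup>2 * u\<^sup>2 = - 1 * u\<^sup>2] (mod int p)"
      using y by (rule cong_scalar_right)
    then have "[(y * u)\<^sup>2 = - (u\<^sup>2)] (mod int p)"
      by (simp add: power_mult_distrib)
    ultimately have "[(y * u)\<^sup>2 = g] (mod int p)"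
      using cong_sym[of g "- (u\<^sup>2)"] cong_trans[of "(y * u)\<^sup>2" "- (u\<^sup>2)" "int p" g] by blast
    with g(1) show False
      by (auto simp: QuadRes_def)
  qed
qed

lemma ex_nonsquare_unit:
  assumes "m = 4 \<or> prime m \<and> odd m"
  shows "\<exists>g. coprime g (int m) \<and> \<not> QuadRes (int m) g"
  using assms
proof
  assume m: "m = 4"
  have "\<not> [y\<^sup>2 = 3] (mod 4)" for y :: int
  proof
    assume "[y\<^sup>2 = 3] (mod 4)"
    then have "(y mod 4)\<^sup>2 mod 4 = 3"
      by (simp add: unique_euclidean_semiring_class.cong_def power_mod)
    moreover have "y mod 4 = 0 \<or> y mod 4 = 1 \<or> y mod 4 = 2 \<or> y mod 4 = 3"
      by presburger
    ultimately show False
      by auto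
  qed
  moreover have "coprime 3 (4 :: int)"
    by code_simp
  ultimately show ?thesis
    using m by (intro exI[of _ 3]) (auto simp: QuadRes_def)
next
  assume m: "prime m \<and> odd m"
  then obtain g where "\<not> QuadRes (int m) g" "\<not> int m dvd g"
    using ex_not_QuadRes by blast
  with m show ?thesis
    using prime_imp_coprime[of "int m" g] coprime_commute[of g "int m"] by auto
qed

text \<open>Beside an odd prime factor \<open>p\<close>, a second odd prime or a factor 4 would give
  two coprime moduli with nonsquare units. Without odd prime factors, \<open>n\<close> is a power of
  2 not divisible by 8.\<close>

lemma units_signed_squares_imp_form:
  assumes n: "n > 1" and uss: "units_signed_squares n"
  shows "\<exists>(p::nat) s::nat. prime p \<and> [p = 3] (mod 4) \<and> s > 0 \<and> n \<in> {2, 4, p ^ s, 2 * p ^ s}"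
proof -
  have no: False
    if "coprime m1 m2" "m1 * m2 dvd n" "m1 = 4 \<or> prime m1 \<and> odd m1" "m2 = 4 \<or> prime m2 \<and> odd m2"
    for m1 m2
  proof -
    have "m1 > 0" "m2 > 0"
      using that(3,4) prime_gt_0_nat by auto
    moreover have "units_signed_squares (m1 * m2)"
      using units_signed_squares_dvd[OF uss that(2)] n by simp
    ultimately show False
      using not_units_signed_squares_mult[OF that(1)] ex_nonsquare_unit[OF that(3)]
        ex_nonsquare_unit[OF that(4)] by blast
  qed
  have two_or_odd: "m = 1 \<or> even m \<or> (\<exists>q. prime q \<and> odd q \<and> q dvd m)" for m :: nat
  proof (cases "m = 1")
    case False
    then obtain q where "prime q" "q dvd m"
      using prime_factor_nat by blast
    then show ?thesis
      using dvd_trans[of 2 q m] by blast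
  qed simp
  show ?thesis
  proof (cases "\<exists>p. prime p \<and> odd p \<and> p dvd n")
    case True
    then obtain p where p: "prime p" "odd p" "p dvd n"
      by blast
    have "n \<noteq> 0" "\<not> is_unit p"
      using n p(1) not_prime_unit by auto
    then obtain s m where m: "n = p ^ s * m" "\<not> p dvd m"
      using multiplicity_decompose'[of n p] by blast
    have s: "s > 0"
      using p(3) m by (cases s) auto
    then have ps: "p dvd p ^ s"
      by simp
    have odd_free: "\<not> q dvd m" if "prime q" "odd q" for q
    proof
      assume "q dvd m"
      then have "q \<noteq> p" "p * q dvd n"
        using m(2) mult_dvd_mono[OF ps, of q m] m(1) by auto
      then show False
        using no[of p q] p that primes_coprime by blast
    qed
    have "m \<in> {1, 2}"
    proof (rule ccontr)
      assume "m \<notin> {1, 2}"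
      then obtain l where l: "m = 2 * l" "l \<noteq> 1"
        using two_or_odd[of m] odd_free by auto
      then have "\<not> q dvd l" if "prime q" "odd q" for q
        using odd_free[OF that] by auto
      then have "even l"
        using two_or_odd[of l] l(2) by blast
      then have "4 dvd m"
        using l by auto
      then have "p * 4 dvd n"
        using mult_dvd_mono[OF ps, of 4 m] m(1) by simp
      moreover have "coprime p 4"
        using p(2) coprime_power_right_iff[of p 2 2] by (simp add: coprime_commute)
      ultimately show False
        using no[of p 4] p by blast
    qed
    moreover have "[p = 3] (mod 4)"
      using units_signed_squares_prime_cong_3 units_signed_squares_dvd[OF uss p(3)] p n by simp
    ultimately show ?thesis
      using p(1) s m(1) by (intro exI[of _ p] exI[of _ s]) auto
  next
    case False
    have "\<not> 8 dvd n"
      using not_units_signed_squares_8 units_signed_squares_dvd[OF uss] n by auto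
    obtain l where l: "n = 2 * l"
      using two_or_odd[of n] n False by auto
    have "l \<in> {1, 2}"
    proof (rule ccontr)
      assume "l \<notin> {1, 2}"
      then obtain k where k: "l = 2 * k" "k \<noteq> 1"
        using two_or_odd[of l] False l by auto
      then have "even k"
        using two_or_odd[of k] False l by auto
      then show False
        using \<open>\<not> 8 dvd n\<close> k l by auto
    qed
    then have "n \<in> {2, 4}"
      using l by auto
    \<comment> \<open>For \<open>n\<close> in \<open>{2, 4}\<close> the witnesses \<open>p\<close>
      and \<open>s\<close> are arbitrary; 3 and 1 are chosen.\<close>
    moreover have "prime (3 :: nat)"
      by simp
    ultimately show ?thesis
      by (intro exI[of _ 3] exI[of _ 1]) auto
  qed
qed

section \<open>Prime powers, their doubles, and the moduli 2 and 4\<close>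

lemma square_cong_1_prime_power:
  fixes x :: int
  assumes "prime p" "odd p" "n = p ^ s \<or> n = 2 * p ^ s" "[x\<^sup>2 = 1] (mod int n)"
  shows "[x = 1] (mod int n) \<or> [x = - 1] (mod int n)"
proof -
  define q where "q = int p ^ s"
  have "q dvd int n"
    using assms(3) by (auto simp: q_def)
  moreover have n_dvd: "int n dvd (x - 1) * (x + 1)"
    using assms(4) by (simp add: cong_iff_dvd_diff power2_eq_square algebra_simps)
  ultimately have q: "q dvd (x - 1) * (x + 1)"
    by (rule dvd_trans)
  have p: "prime (int p)"
    using assms(1) by simp
  \<comment> \<open>A common factor \<open>p\<close> would divide the difference 2, so all of
    \<open>q\<close> divides one of the two factors.\<close>
  have "\<not> (int p dvd x - 1 \<and> int p dvd x + 1)"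
  proof
    assume "int p dvd x - 1 \<and> int p dvd x + 1"
    then have "int p dvd (x + 1) - (x - 1)"
      by (elim conjE) (rule dvd_diff)
    then have "p dvd 2"
      using int_dvd_int_iff[of p 2] by simp
    then show False
      using assms(1,2) primes_dvd_imp_eq two_is_prime_nat by blast
  qed
  then have "coprime (int p) (x - 1) \<or> coprime (int p) (x + 1)"
    using prime_imp_coprime[OF p] by blast
  then have "q dvd x - 1 \<or> q dvd x + 1"
    using q by (auto simp: q_def coprime_dvd_mult_right_iff coprime_dvd_mult_left_iff)
  moreover have "int n dvd y" if y: "q dvd y" "y = x - 1 \<or> y = x + 1" for y
  proof (cases "n = p ^ s")
    case False
    then have n: "int n = 2 * q"
      using assms(3) by (simp add: q_def)
    \<comment> \<open>The factors \<open>x - 1\<close> and \<open>x + 1\<close> have equal parity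
      and an even product, so \<open>y\<close> is divisible by 2 as well as by
      \<open>q\<close>.\<close>
    then have "2 dvd int n"
      by simp
    then have "2 dvd (x - 1) * (x + 1)"
      using n_dvd by (rule dvd_trans)
    then have "even y"
      using y(2) by auto
    moreover have "coprime 2 q"
      using assms(2) by (simp add: q_def)
    ultimately show ?thesis
      using y(1) n divides_mult by auto
  qed (use y in \<open>simp add: q_def\<close>)
  ultimately show ?thesis
    by (auto simp: cong_iff_dvd_diff)
qed

text \<open>
  As \<open>\<phi>(n) = 2k\<close> with \<open>k\<close> odd, \<open>a ^ k = \<plusminus>1\<close> and \<open>a ^ (k + 1)\<close> is a square.
\<close>

lemma units_signed_squares_prime_power:
  assumes p: "prime p" "[p = 3] (mod 4)" and s: "s > 0" and n: "n = p ^ s \<or> n = 2 * p ^ s"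
  shows "units_signed_squares n"
  unfolding units_signed_squares_def
proof (intro allI impI)
  fix a :: int
  assume a: "coprime a (int n)"
  have p4: "p mod 4 = 3"
    using p(2) by (simp add: unique_euclidean_semiring_class.cong_def)
  then have odd: "odd p"
    by presburger
  have n0: "n > 0"
    using n prime_gt_0_nat[OF p(1)] by auto
  have "totient n = p ^ (s - 1) * (p - 1)"
    using n
  proof
    assume "n = 2 * p ^ s"
    moreover have "coprime 2 (p ^ s)"
      using odd by simp
    ultimately show ?thesis
      using p(1) s by (simp add: totient_mult_coprime totient_prime_power)
  qed (use p(1) s in \<open>simp add: totient_prime_power\<close>)
  moreover define k where "k = p ^ (s - 1) * ((p - 1) div 2)"
  \<comment> \<open>Here \<open>p\<close> being 3 modulo 4 enters: \<open>(p - 1) div 2\<close> is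
    odd, and with it \<open>k\<close>.\<close>
  moreover have "p - 1 = 2 * ((p - 1) div 2)" "odd ((p - 1) div 2)"
    using p4 by (presburger+)
  ultimately have k: "totient n = 2 * k" "odd k"
    using odd by (simp_all add: k_def)
  define b where "b = nat (a mod int n)"
  have b: "[int b = a] (mod int n)"
    using n0 by (simp add: b_def)
  have "coprime b n"
    using cong_imp_coprime[OF cong_sym[OF b] a] by simp
  then have "[b ^ totient n = 1] (mod n)"
    by (rule euler_theorem)
  then have "[int (b ^ totient n) = int 1] (mod int n)"
    by (simp only: cong_int_iff)
  then have "[(int b ^ k)\<^sup>2 = 1] (mod int n)"
    by (simp add: k(1) mult.commute flip: power_mult)
  then have bk: "[int b ^ k = 1] (mod int n) \<or> [int b ^ k = - 1] (mod int n)"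
    using square_cong_1_prime_power[OF p(1) odd n] by blast
  obtain j where j: "Suc k = 2 * j"
    using k(2) by (metis dvdE even_Suc)
  have "(int b ^ j)\<^sup>2 = int b ^ Suc k"
    by (simp only: j mult.commute[of 2] power_mult)
  then have sq: "(int b ^ j)\<^sup>2 = int b ^ k * int b"
    by simp
  from bk have "[int b = (int b ^ j)\<^sup>2] (mod int n) \<or> [int b = - ((int b ^ j)\<^sup>2)] (mod int n)"
  proof
    assume "[int b ^ k = 1] (mod int n)"
    then have "[int b ^ k * int b = 1 * int b] (mod int n)"
      by (rule cong_scalar_right)
    then have "[int b = int b ^ k * int b] (mod int n)"
      unfolding mult_1_left by (rule cong_sym)
    then show ?thesis
      unfolding sq by (rule disjI1)
  next
    assume "[int b ^ k = - 1] (mod int n)"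
    then have "[int b ^ k * - int b = - 1 * - int b] (mod int n)"
      by (rule cong_scalar_right)
    then have "[- (int b ^ k * int b) = int b] (mod int n)"
      by simp
    then have "[int b = - (int b ^ k * int b)] (mod int n)"
      by (rule cong_sym)
    then show ?thesis
      unfolding sq by (rule disjI2)
  qed
  moreover have "coprime (int b ^ j) (int n)"
    using \<open>coprime b n\<close> by simp
  ultimately have "signed_unit_square n (int b)"
    unfolding signed_unit_square_def by blast
  then show "signed_unit_square n a"
    using signed_unit_square_cong[OF b] by simp
qed

text \<open>Odd numbers are 1 or -1 modulo 4, so \<open>u = 1\<close> serves for every unit.\<close>

lemma units_signed_squares_2_4:
  assumes "n = 2 \<or> n = 4"
  shows "units_signed_squares n"
  unfolding units_signed_squares_def
proof (intro allI impI)
  fix a assume "coprime a (int n)"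
  then have "odd a"
    using assms by auto
  then have "[a = 1] (mod 4) \<or> [a = - 1] (mod 4)"
    unfolding cong_iff_dvd_diff by presburger
  then have "[a = 1] (mod int n) \<or> [a = - 1] (mod int n)"
    using assms cong_dvd_modulus[of a _ 4 2] by auto
  then show "signed_unit_square n a"
    unfolding signed_unit_square_def by (intro exI[of _ 1]) simp
qed

theorem corollary4p15p1:
  fixes n :: nat
  assumes "n > 1"
  shows "periodic_graph (quadratic_unitary_Cayley_graph n) \<longleftrightarrow>
    (\<exists>(p::nat) s::nat. prime p \<and> [p = 3] (mod 4) \<and> s > 0 \<and> n \<in> {2, 4, p ^ s, 2 * p ^ s})"
  unfolding periodic_iff_units_signed_squares[OF assms]
  using units_signed_squares_imp_form[OF assms] units_signed_squares_2_4 units_signed_squares_prime_power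
  by blast

end
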